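(* If $G$ is a finite group, $k$ is a field (of arbitrary characteristic), and $V$ is a finite-dimensional representation of $G$ over $k$, then $$D_{\mathrm{span}}(G,V) \leq |G| - 1.$$
   Context: $k[V]$ is the ring of polynomial functions on $V$ (the symmetric algebra of $V^*$), with $G$-action $(gf)(v)=f(g^{-1}v)$; $k(V)$ is its fraction field and $k(V)^G$ the field of $G$-invariant rational functions; $k[V]_{\le d}$ is the space of polynomials of degree at most $d$. The spanning degree $D_{\mathrm{span}}(G,V)$ is the minimum $d\in\mathbb{N}=\{0,1,2,\dots\}$ such that $k[V]_{\le d}$ spans $k(V)$ as a vector space over $k(V)^G$. *)

theory Defs
  imports
    "HOL-Library.Poly_Mapping"
    "HOL-Library.Extended_Nat"
    "HOL-Computational_Algebra.Polynomial_Factorial"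
    "HOL-Algebra.Group_Action"
begin

text \<open>
  A representation of a group \<open>G\<close> on a finite-dimensional vector space \<open>V\<close> over a field: \<open>V\<close> is the
  whole type \<open>'v\<close> with scalar multiplication \<open>scale\<close>, and the list \<open>bs\<close> is an ordered basis of it
  (empty if \<open>V = 0\<close>).  The basis serves only to write \<open>k[V]\<close> as a polynomial ring.
\<close>

locale fin_dim_rep =
  finite_dimensional_vector_space scale "set bs" + group_action G UNIV \<rho>
  for G :: "('g, 'm) monoid_scheme" (structure)
    and scale :: "'k::field \<Rightarrow> 'v::ab_group_add \<Rightarrow> 'v" and bs :: "'v list"
    and \<rho> :: "'g \<Rightarrow> 'v \<Rightarrow> 'v" +
  assumes distinct_basis: "distinct bs"
    and linear_action: "g \<in> carrier G \<Longrightarrow> Vector_Spaces.linear scale scale (\<rho> g)"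

text \<open>
  Polynomials in variables \<open>x\<^sub>0, x\<^sub>1, \<dots>\<close>, as finitely supported maps from exponents to coefficients.
  These are formal polynomials, so over a finite field distinct ones may agree at all points of \<open>V\<close>.
\<close>

type_synonym 'k mpoly = "(nat \<Rightarrow>\<^sub>0 nat) \<Rightarrow>\<^sub>0 'k"

definition const :: "'k::zero \<Rightarrow> 'k mpoly"
  where "const c = Poly_Mapping.single 0 c"

definition var :: "nat \<Rightarrow> 'k::zero_neq_one mpoly"
  where "var i = Poly_Mapping.single (Poly_Mapping.single i 1) 1"

definition mon_degree :: "(nat \<Rightarrow>\<^sub>0 nat) \<Rightarrow> nat"
  where "mon_degree m = (\<Sum>i\<in>Poly_Mapping.keys m. Poly_Mapping.lookup m i)"

text \<open>Evaluation at \<open>x\<^sub>i = \<sigma> i\<close>, with coefficients mapped by \<open>c\<close>.\<close>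

definition mpoly_eval :: "('k::zero \<Rightarrow> 'r::comm_ring_1) \<Rightarrow> (nat \<Rightarrow> 'r) \<Rightarrow> 'k mpoly \<Rightarrow> 'r"
  where "mpoly_eval c \<sigma> p = (\<Sum>m\<in>Poly_Mapping.keys p. c (Poly_Mapping.lookup p m) *
     (\<Prod>i\<in>Poly_Mapping.keys m. \<sigma> i ^ Poly_Mapping.lookup m i))"

text \<open>
  \<open>k[V]\<close>, the symmetric algebra of \<open>V\<^sup>*\<close>: polynomials in \<open>x\<^sub>i\<close> for \<open>i < length bs\<close>, where \<open>x\<^sub>i\<close> is the
  \<open>i\<close>-th coordinate function with respect to \<open>bs\<close>.
\<close>

definition coord_ring :: "'v list \<Rightarrow> 'k::zero mpoly set"
  where "coord_ring bs = {p. \<forall>m\<in>Poly_Mapping.keys p. Poly_Mapping.keys m \<subseteq> {..<length bs}}"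

definition coord_ring_le :: "'v list \<Rightarrow> nat \<Rightarrow> 'k::zero mpoly set"
  where "coord_ring_le bs d = {p \<in> coord_ring bs. \<forall>m\<in>Poly_Mapping.keys p. mon_degree m \<le> d}"

definition coord :: "('k::field \<Rightarrow> 'v::ab_group_add \<Rightarrow> 'v) \<Rightarrow> 'v list \<Rightarrow> nat \<Rightarrow> 'v \<Rightarrow> 'k"
  where "coord scale bs i v = module.representation scale (set bs) v (bs ! i)"

text \<open>The inclusion of \<open>V\<^sup>*\<close> in \<open>k[V]\<close>.\<close>

definition linear_form :: "'v list \<Rightarrow> ('v \<Rightarrow> 'k::field) \<Rightarrow> 'k mpoly"
  where "linear_form bs l = (\<Sum>j<length bs. const (l (bs ! j)) * var j)"

text \<open>
  The action on \<open>k[V]\<close> is the algebra homomorphism determined by \<open>x\<^sub>i \<mapsto> x\<^sub>i \<circ> \<rho>(g\<^sup>-\<^sup>1)\<close>; see \<open>eval_poly_act\<close>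
  below for \<open>(g f)(v) = f(g\<^sup>-\<^sup>1 v)\<close>.
\<close>

definition poly_act ::
  "('g, 'm) monoid_scheme \<Rightarrow> ('k::field \<Rightarrow> 'v::ab_group_add \<Rightarrow> 'v) \<Rightarrow> 'v list \<Rightarrow>
   ('g \<Rightarrow> 'v \<Rightarrow> 'v) \<Rightarrow> 'g \<Rightarrow> 'k mpoly \<Rightarrow> 'k mpoly"
  where "poly_act G scale bs \<rho> g =
    mpoly_eval const (\<lambda>i. linear_form bs (\<lambda>v. coord scale bs i (\<rho> (inv\<^bsub>G\<^esub> g) v)))"

text \<open>\<open>k(V)\<close>\<close>

definition rat_fun_field :: "'v list \<Rightarrow> 'k::field mpoly fract set"
  where "rat_fun_field bs = {Fract p q |p q. p \<in> coord_ring bs \<and> q \<in> coord_ring bs \<and> q \<noteq> 0}"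

text \<open>
  The induced action on \<open>k(V)\<close>, \<open>g (p/q) = (g p)/(g q)\<close>; that this is independent of the choice of
  \<open>p\<close> and \<open>q\<close> is \<open>rat_act_Fract\<close> below.  It is only meaningful on elements of \<open>k(V)\<close>.
\<close>

definition rat_act ::
  "('g, 'm) monoid_scheme \<Rightarrow> ('k::field \<Rightarrow> 'v::ab_group_add \<Rightarrow> 'v) \<Rightarrow> 'v list \<Rightarrow>
   ('g \<Rightarrow> 'v \<Rightarrow> 'v) \<Rightarrow> 'g \<Rightarrow> 'k mpoly fract \<Rightarrow> 'k mpoly fract"
  where "rat_act G scale bs \<rho> g f = (THE f'. \<exists>p q. p \<in> coord_ring bs \<and> q \<in> coord_ring bs \<and> q \<noteq> 0 \<and>
     f = Fract p q \<and> f' = Fract (poly_act G scale bs \<rho> g p) (poly_act G scale bs \<rho> g q))"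

definition inv_field ::
  "('g, 'm) monoid_scheme \<Rightarrow> ('k::field \<Rightarrow> 'v::ab_group_add \<Rightarrow> 'v) \<Rightarrow> 'v list \<Rightarrow>
   ('g \<Rightarrow> 'v \<Rightarrow> 'v) \<Rightarrow> 'k mpoly fract set"
  where "inv_field G scale bs \<rho> =
    {f \<in> rat_fun_field bs. \<forall>g\<in>carrier G. rat_act G scale bs \<rho> g f = f}"

text \<open>Linear span over a subfield \<open>F\<close>.\<close>

definition span_over :: "'r::field set \<Rightarrow> 'r set \<Rightarrow> 'r set"
  where "span_over F S = {\<Sum>s\<in>T. c s * s |T c. finite T \<and> T \<subseteq> S \<and> c ` T \<subseteq> F}"

text \<open>The minimum is taken in \<open>enat\<close>, so it would be \<open>\<infinity>\<close> if no degree worked.\<close>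

definition spanning_degree ::
  "('g, 'm) monoid_scheme \<Rightarrow> ('k::field \<Rightarrow> 'v::ab_group_add \<Rightarrow> 'v) \<Rightarrow> 'v list \<Rightarrow>
   ('g \<Rightarrow> 'v \<Rightarrow> 'v) \<Rightarrow> enat"
  where "spanning_degree G scale bs \<rho> =
    (INF d\<in>{d. span_over (inv_field G scale bs \<rho>) (to_fract ` coord_ring_le bs d) = rat_fun_field bs}.
       enat d)"


subsection \<open>Evaluation is a homomorphism\<close>

lemma prod_keys_superset:
  assumes "finite A" "Poly_Mapping.keys m \<subseteq> A"
  shows "(\<Prod>i\<in>Poly_Mapping.keys m. \<sigma> i ^ Poly_Mapping.lookup m i) =
         (\<Prod>i\<in>A. (\<sigma> i :: 'r::comm_ring_1) ^ Poly_Mapping.lookup m i)"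
  by (rule prod.mono_neutral_left) (use assms in \<open>auto simp: in_keys_iff\<close>)

lemma prod_keys_add:
  "(\<Prod>i\<in>Poly_Mapping.keys (m + m'). (\<sigma> i :: 'r::comm_ring_1) ^ Poly_Mapping.lookup (m + m') i) =
   (\<Prod>i\<in>Poly_Mapping.keys m. \<sigma> i ^ Poly_Mapping.lookup m i) *
   (\<Prod>i\<in>Poly_Mapping.keys m'. \<sigma> i ^ Poly_Mapping.lookup (m' :: nat \<Rightarrow>\<^sub>0 nat) i)"
proof -
  let ?A = "Poly_Mapping.keys m \<union> Poly_Mapping.keys m'"
  have "Poly_Mapping.keys (m + m') \<subseteq> ?A" by (rule Poly_Mapping.keys_add)
  then show ?thesis
    by (subst (1 2 3) prod_keys_superset[of ?A])
       (auto simp: lookup_add power_add prod.distrib)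
qed

locale coeff_hom =
  fixes c :: "'k::field \<Rightarrow> 'r::comm_ring_1"
  assumes c_0: "c 0 = 0" and c_1: "c 1 = 1"
    and c_add: "c (a + b) = c a + c b" and c_mult: "c (a * b) = c a * c b"
begin

lemma eval_superset:
  assumes "finite A" "Poly_Mapping.keys p \<subseteq> A"
  shows "mpoly_eval c \<sigma> p = (\<Sum>m\<in>A. c (Poly_Mapping.lookup p m) *
     (\<Prod>i\<in>Poly_Mapping.keys m. \<sigma> i ^ Poly_Mapping.lookup m i))"
  unfolding mpoly_eval_def
  by (rule sum.mono_neutral_left) (use assms in \<open>auto simp: in_keys_iff c_0\<close>)

lemma eval_add: "mpoly_eval c \<sigma> (p + q) = mpoly_eval c \<sigma> p + mpoly_eval c \<sigma> q"
proof -
  let ?A = "Poly_Mapping.keys p \<union> Poly_Mapping.keys q"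
  have "Poly_Mapping.keys (p + q) \<subseteq> ?A" by (rule Poly_Mapping.keys_add)
  then show ?thesis
    by (subst (1 2 3) eval_superset[of ?A])
       (auto simp: lookup_add c_add ring_distribs sum.distrib)
qed

lemma eval_single:
  "mpoly_eval c \<sigma> (Poly_Mapping.single m a) =
   c a * (\<Prod>i\<in>Poly_Mapping.keys m. \<sigma> i ^ Poly_Mapping.lookup m i)"
  by (subst eval_superset[of "{m}"]) auto

lemma eval_0: "mpoly_eval c \<sigma> 0 = 0"
  by (simp add: mpoly_eval_def)

lemma eval_1: "mpoly_eval c \<sigma> 1 = 1"
  unfolding single_one[symmetric] eval_single by (simp add: c_1)

lemma eval_const: "mpoly_eval c \<sigma> (const a) = c a"
  by (simp add: const_def eval_single)

lemma eval_var: "mpoly_eval c \<sigma> (var i) = \<sigma> i"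
  by (simp add: var_def eval_single c_1)

lemma eval_sum: "mpoly_eval c \<sigma> (\<Sum>a\<in>A. f a) = (\<Sum>a\<in>A. mpoly_eval c \<sigma> (f a))"
  by (induction A rule: infinite_finite_induct) (auto simp: eval_0 eval_add)

lemma sum_singles:
  "(\<Sum>m\<in>Poly_Mapping.keys p. Poly_Mapping.single m (Poly_Mapping.lookup p m)) = p"
  by (rule poly_mapping_eqI)
     (auto simp: lookup_sum lookup_single when_def in_keys_iff sum.delta)

lemma eval_mult: "mpoly_eval c \<sigma> (p * q) = mpoly_eval c \<sigma> p * mpoly_eval c \<sigma> q"
proof -
  let ?s = "\<lambda>p. (\<Sum>m\<in>Poly_Mapping.keys p. Poly_Mapping.single m (Poly_Mapping.lookup p m)) :: 'k mpoly"
  have "mpoly_eval c \<sigma> (?s p * ?s q) = mpoly_eval c \<sigma> (?s p) * mpoly_eval c \<sigma> (?s q)"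
    unfolding sum_product eval_sum mult_single eval_single prod_keys_add c_mult
    by (simp add: algebra_simps)
  then show ?thesis by (simp only: sum_singles)
qed

lemma eval_power: "mpoly_eval c \<sigma> (p ^ n) = mpoly_eval c \<sigma> p ^ n"
  by (induction n) (auto simp: eval_1 eval_mult)

lemma eval_prod: "mpoly_eval c \<sigma> (\<Prod>a\<in>A. f a) = (\<Prod>a\<in>A. mpoly_eval c \<sigma> (f a))"
  by (induction A rule: infinite_finite_induct) (auto simp: eval_1 eval_mult)

lemma eval_linear_form:
  "mpoly_eval c \<sigma> (linear_form bs l) = (\<Sum>j<length bs. c (l (bs ! j)) * \<sigma> j)"
  by (simp add: linear_form_def eval_sum eval_mult eval_const eval_var)

text \<open>Evaluation after substitution.\<close>

lemma eval_subst:
  "mpoly_eval c \<sigma> (mpoly_eval const \<tau> p) = mpoly_eval c (\<lambda>i. mpoly_eval c \<sigma> (\<tau> i)) p"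
  by (simp add: mpoly_eval_def[of const \<tau> p] eval_sum eval_mult eval_prod eval_power eval_const)
     (simp add: mpoly_eval_def)

end

lemma mpoly_eval_cong:
  assumes "p \<in> coord_ring bs" "\<And>i. i < length bs \<Longrightarrow> \<sigma> i = \<tau> i"
  shows "mpoly_eval c \<sigma> p = mpoly_eval c \<tau> p"
  unfolding mpoly_eval_def
  by (intro sum.cong prod.cong refl arg_cong2[where f = "(*)"] arg_cong2[where f = "(^)"] assms(2))
     (use assms(1) in \<open>auto simp: coord_ring_def\<close>)

interpretation const: coeff_hom "const :: 'k::field \<Rightarrow> 'k mpoly"
  by unfold_locales (auto simp: const_def single_add mult_single)

interpretation ident: coeff_hom "\<lambda>a::'k::field. a"
  by unfold_locales auto

lemma single_var_power: "var i ^ n = Poly_Mapping.single (Poly_Mapping.single i n) (1::'k::field)"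
proof (induction n)
  case (Suc n)
  then show ?case by (simp add: var_def mult_single flip: single_add)
qed simp

lemma prod_single_one:
  "finite A \<Longrightarrow> (\<Prod>i\<in>A. Poly_Mapping.single (f i) (1::'k::field)) =
    Poly_Mapping.single (\<Sum>i\<in>A. f i :: nat \<Rightarrow>\<^sub>0 nat) 1"
  by (induction A rule: finite_induct) (auto simp: mult_single)

lemma sum_singles_exponent:
  "(\<Sum>i\<in>Poly_Mapping.keys m. Poly_Mapping.single i (Poly_Mapping.lookup m i)) = (m :: nat \<Rightarrow>\<^sub>0 nat)"
  by (rule poly_mapping_eqI)
     (auto simp: lookup_sum lookup_single when_def in_keys_iff sum.delta)

lemma eval_vars: "mpoly_eval const var p = (p :: 'k::field mpoly)"
  unfolding mpoly_eval_def single_var_power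
  by (simp add: prod_single_one sum_singles_exponent const_def mult_single const.sum_singles)


subsection \<open>The actions\<close>

context fin_dim_rep
begin

sublocale G: group G
  by (rule group_hom.axioms(1)[OF group_hom])

lemma rho_mult:
  "g \<in> carrier G \<Longrightarrow> h \<in> carrier G \<Longrightarrow> \<rho> (g \<otimes> h) v = \<rho> g (\<rho> h v)"
  using composition_rule by simp

lemma rho_one: "\<rho> \<one> v = v"
  using id_eq_one by (metis restrict_apply UNIV_I)

lemma nth_in_basis: "i < length bs \<Longrightarrow> bs ! i \<in> set bs"
  by simp

lemma coord_expansion: "(\<Sum>j<length bs. scale (coord scale bs j v) (bs ! j)) = v"
proof -
  have "v = (\<Sum>b\<in>set bs. scale (representation (set bs) v b) b)"
    using sum_representation_eq[OF independent_Basis _ finite_Basis order.refl, of v]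
    by (simp add: span_Basis)
  also have "\<dots> = (\<Sum>j<length bs. scale (coord scale bs j v) (bs ! j))"
    unfolding coord_def
    by (rule sum.reindex_bij_betw[symmetric])
       (metis bij_betw_nth distinct_basis)
  finally show ?thesis by simp
qed

lemma coord_basis:
  "i < length bs \<Longrightarrow> j < length bs \<Longrightarrow> coord scale bs i (bs ! j) = (if i = j then 1 else 0)"
  by (auto simp: coord_def representation_basis[OF independent_Basis nth_in_basis] nth_eq_iff_index_eq[OF distinct_basis])

lemma linear_coord:
  assumes "i < length bs"
  shows "Vector_Spaces.linear scale (*) (coord scale bs i)"
  unfolding coord_def
  by (rule linear_representation) (auto simp: independent_Basis span_Basis)

lemma linear_coord_action:
  assumes "i < length bs" "g \<in> carrier G"
  shows "Vector_Spaces.linear scale (*) (\<lambda>v. coord scale bs i (\<rho> g v))"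
  using Vector_Spaces.linear_compose[OF linear_action[OF assms(2)] linear_coord[OF assms(1)]]
  by (simp add: o_def)

lemma linear_expansion:
  assumes "Vector_Spaces.linear scale (*) l"
  shows "(\<Sum>j<length bs. l (bs ! j) * coord scale bs j v) = l v"
proof -
  interpret l: Vector_Spaces.linear scale "(*)" l by fact
  have "l v = l (\<Sum>j<length bs. scale (coord scale bs j v) (bs ! j))" by (simp add: coord_expansion)
  also have "\<dots> = (\<Sum>j<length bs. coord scale bs j v * l (bs ! j))"
    by (simp add: l.sum l.scale)
  finally show ?thesis by (simp add: mult.commute)
qed

abbreviation "act \<equiv> poly_act G scale bs \<rho>"
abbreviation "ract \<equiv> rat_act G scale bs \<rho>"

text \<open>\<open>(g f)(v) = f(g\<^sup>-\<^sup>1 v)\<close>\<close>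

lemma eval_poly_act:
  assumes "p \<in> coord_ring bs" "g \<in> carrier G"
  shows "mpoly_eval (\<lambda>a. a) (\<lambda>i. coord scale bs i v) (act g p) =
         mpoly_eval (\<lambda>a. a) (\<lambda>i. coord scale bs i (\<rho> (inv g) v)) p"
  unfolding poly_act_def ident.eval_subst
  by (rule mpoly_eval_cong[OF assms(1)])
     (use assms(2) in \<open>auto simp: ident.eval_linear_form linear_expansion[OF linear_coord_action]\<close>)

lemma poly_act_linear_form:
  assumes "Vector_Spaces.linear scale (*) l" "g \<in> carrier G"
  shows "act g (linear_form bs l) = linear_form bs (\<lambda>v. l (\<rho> (inv g) v))"
proof -
  have "act g (linear_form bs l) =
      (\<Sum>j<length bs. const (l (bs ! j)) *
         (\<Sum>i<length bs. const (coord scale bs j (\<rho> (inv g) (bs ! i))) * var i))"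
    by (simp add: poly_act_def const.eval_linear_form) (simp add: linear_form_def)
  also have "\<dots> = (\<Sum>i<length bs. \<Sum>j<length bs.
         const (l (bs ! j) * coord scale bs j (\<rho> (inv g) (bs ! i))) * var i)"
    unfolding sum_distrib_left by (subst sum.swap) (simp add: const.c_mult mult.assoc)
  also have "\<dots> = (\<Sum>i<length bs. const (\<Sum>j<length bs.
         l (bs ! j) * coord scale bs j (\<rho> (inv g) (bs ! i))) * var i)"
  proof -
    have const_sum: "const (sum f A) = (\<Sum>a\<in>A. const (f a))" for f :: "nat \<Rightarrow> 'k" and A
      by (induction A rule: infinite_finite_induct) (auto simp: const.c_0 const.c_add)
    show ?thesis by (simp add: const_sum sum_distrib_right)
  qed
  also have "\<dots> = linear_form bs (\<lambda>v. l (\<rho> (inv g) v))"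
    by (simp add: linear_expansion[OF assms(1)] linear_form_def)
  finally show ?thesis .
qed

lemma poly_act_one: assumes "p \<in> coord_ring bs" shows "act \<one> p = p"
proof -
  have "act \<one> p = mpoly_eval const var p"
    unfolding poly_act_def
    by (rule mpoly_eval_cong[OF assms])
       (simp add: linear_form_def rho_one coord_basis if_distrib[of const] const.c_0 const.c_1
         if_distrib[of "\<lambda>a. a * _"] sum.delta cong: if_cong)
  then show ?thesis by (simp add: eval_vars)
qed

lemma poly_act_mult:
  assumes "p \<in> coord_ring bs" "g \<in> carrier G" "h \<in> carrier G"
  shows "act g (act h p) = act (g \<otimes> h) p"
proof -
  have "act g (act h p) =
      mpoly_eval const (\<lambda>i. act g (linear_form bs (\<lambda>v. coord scale bs i (\<rho> (inv h) v)))) p"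
    unfolding poly_act_def const.eval_subst ..
  also have "\<dots> = act (g \<otimes> h) p"
    unfolding poly_act_def[of _ _ _ _ "g \<otimes> h"]
    by (rule mpoly_eval_cong[OF assms(1)])
       (use assms(2,3) in \<open>simp add: poly_act_linear_form linear_coord_action G.inv_mult_group rho_mult\<close>)
  finally show ?thesis .
qed

lemma poly_act_eq_0_iff:
  assumes "p \<in> coord_ring bs" "g \<in> carrier G"
  shows "act g p = 0 \<longleftrightarrow> p = 0"
proof
  assume "act g p = 0"
  then have "act (inv g) (act g p) = 0" by (simp add: poly_act_def const.eval_0)
  then show "p = 0" using assms by (simp add: poly_act_mult poly_act_one)
qed (simp add: poly_act_def const.eval_0)

lemma rat_act_Fract:
  assumes "p \<in> coord_ring bs" "q \<in> coord_ring bs" "q \<noteq> 0" "g \<in> carrier G"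
  shows "ract g (Fract p q) = Fract (act g p) (act g q)"
  unfolding rat_act_def
proof (rule the_equality)
  fix f' assume "\<exists>p' q'. p' \<in> coord_ring bs \<and> q' \<in> coord_ring bs \<and> q' \<noteq> 0 \<and>
     Fract p q = Fract p' q' \<and> f' = Fract (act g p') (act g q')"
  then obtain p' q' where *: "p' \<in> coord_ring bs" "q' \<in> coord_ring bs" "q' \<noteq> 0"
     "Fract p q = Fract p' q'" "f' = Fract (act g p') (act g q')" by blast
  then have "p * q' = p' * q" using assms by (simp add: eq_fract)
  then have "act g (p * q') = act g (p' * q)" by simp
  then have "act g p * act g q' = act g p' * act g q"
    by (simp add: poly_act_def const.eval_mult)
  then show "f' = Fract (act g p) (act g q)"
    using * assms by (simp add: eq_fract poly_act_eq_0_iff)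
qed (use assms in blast)

end

end

theory Submission imports Defs
begin

text \<open>
  Let \<open>E\<close> be the image of \<open>G\<close> in the automorphism group of \<open>k(V)\<close>.  Every \<open>h \<noteq> id\<close> in \<open>E\<close> moves some
  coordinate function \<open>x\<^sub>h\<close>.  For \<open>e \<in> E\<close> the product over all \<open>h \<noteq> id\<close> of
  \<open>(x\<^sub>h - e (h x\<^sub>h)) / (e x\<^sub>h - e (h x\<^sub>h))\<close> is \<open>1\<close> if \<open>e = id\<close>, and \<open>0\<close> otherwise, since then some \<open>h\<close>
  is the inverse of \<open>e\<close>.  Multiplying by \<open>e f\<close>, summing over \<open>e\<close> and expanding the numerators therefore
  writes \<open>f\<close> as a combination of the products of the \<open>x\<^sub>h\<close> over the subsets of \<open>E - {id}\<close>, and the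
  coefficients are traces, hence invariant.
\<close>

text \<open>\<open>span_over\<close> attaches one coefficient to each vector, while the combination
  here is indexed by \<open>J\<close>, where \<open>a\<close> may repeat. The coefficients of equal
  vectors are collected in \<open>d\<close>.\<close>

lemma span_overI:
  assumes "finite J" "a ` J \<subseteq> S" "c ` J \<subseteq> F"
    and "0 \<in> F" "\<And>x y. x \<in> F \<Longrightarrow> y \<in> F \<Longrightarrow> x + y \<in> F"
  shows "(\<Sum>j\<in>J. c j * a j) \<in> span_over F S"
proof -
  define d where "d s = (\<Sum>j | j \<in> J \<and> a j = s. c j)" for s
  have sum_F: "sum c I \<in> F" if "I \<subseteq> J" for I
    using finite_subset[OF that assms(1)] that
    by (induction I rule: finite_induct) (use assms in auto)
  have "(\<Sum>j\<in>J. c j * a j) = (\<Sum>s\<in>a ` J. \<Sum>j | j \<in> J \<and> a j = s. c j * a j)"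
    by (rule sum.image_gen[OF assms(1)])
  also have "\<dots> = (\<Sum>s\<in>a ` J. d s * s)"
    by (simp add: d_def sum_distrib_right)
  finally show ?thesis
    unfolding span_over_def
    by (intro CollectI exI[of _ d] exI[of _ "a ` J"] conjI)
       (use assms(1,2) sum_F in \<open>auto simp: d_def\<close>)
qed


subsection \<open>Finite groups of automorphisms of a field\<close>

text \<open>\<open>K\<close> is a set because \<open>k(V)\<close> sits inside the fractions in
  infinitely many variables. Identities between members of \<open>E\<close> are equalities of total
  functions, also outside \<open>K\<close>.\<close>

locale finite_automorphism_group =
  fixes K :: "'r::field set" and E :: "('r \<Rightarrow> 'r) set"
  assumes one_mem: "1 \<in> K"
    and add_mem: "x \<in> K \<Longrightarrow> y \<in> K \<Longrightarrow> x + y \<in> K"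
    and uminus_mem: "x \<in> K \<Longrightarrow> - x \<in> K"
    and mult_mem: "x \<in> K \<Longrightarrow> y \<in> K \<Longrightarrow> x * y \<in> K"
    and inverse_mem: "x \<in> K \<Longrightarrow> inverse x \<in> K"
    and finite_E: "finite E"
    and id_E: "id \<in> E"
    and comp_E: "e \<in> E \<Longrightarrow> e' \<in> E \<Longrightarrow> e \<circ> e' \<in> E"
    and inv_E: "e \<in> E \<Longrightarrow> \<exists>e'\<in>E. e' \<circ> e = id \<and> e \<circ> e' = id"
    and aut_mem: "e \<in> E \<Longrightarrow> x \<in> K \<Longrightarrow> e x \<in> K"
    and aut_add: "e \<in> E \<Longrightarrow> x \<in> K \<Longrightarrow> y \<in> K \<Longrightarrow> e (x + y) = e x + e y"
    and aut_mult: "e \<in> E \<Longrightarrow> x \<in> K \<Longrightarrow> y \<in> K \<Longrightarrow> e (x * y) = e x * e y"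
begin

definition fixed_field :: "'r set"
  where "fixed_field = {y \<in> K. \<forall>e\<in>E. e y = y}"

lemma zero_mem: "0 \<in> K"
  using add_mem[OF one_mem uminus_mem[OF one_mem]] by simp

lemma diff_mem: "x \<in> K \<Longrightarrow> y \<in> K \<Longrightarrow> x - y \<in> K"
  using add_mem[OF _ uminus_mem, of x y] by simp

lemma sum_mem: "(\<And>i. i \<in> I \<Longrightarrow> f i \<in> K) \<Longrightarrow> sum f I \<in> K"
  by (induction I rule: infinite_finite_induct) (auto intro: zero_mem add_mem)

lemma prod_mem: "(\<And>i. i \<in> I \<Longrightarrow> f i \<in> K) \<Longrightarrow> prod f I \<in> K"
  by (induction I rule: infinite_finite_induct) (auto intro: one_mem mult_mem)

lemma inj_aut: "e \<in> E \<Longrightarrow> inj e"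
  using inv_E by (metis inj_on_id inj_on_imageI2)

lemma aut_0: "e \<in> E \<Longrightarrow> e 0 = 0"
  using aut_add[OF _ zero_mem zero_mem] by (metis add_cancel_right_right)

lemma aut_1: assumes "e \<in> E" shows "e 1 = 1"
proof -
  \<comment> \<open>An idempotent of a field is 0 or 1, and injectivity excludes 0.\<close>
  have "e 1 * e 1 = e 1" using aut_mult[OF assms one_mem one_mem] by simp
  moreover have "e 1 \<noteq> 0" using inj_aut[OF assms] aut_0[OF assms] by (metis injD one_neq_zero)
  ultimately show ?thesis by simp
qed

lemma aut_uminus: "e \<in> E \<Longrightarrow> x \<in> K \<Longrightarrow> e (- x) = - e x"
  using aut_add[OF _ _ uminus_mem, of e x x] aut_0[of e] by (simp add: eq_neg_iff_add_eq_0 add.commute)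

lemma aut_sum: "e \<in> E \<Longrightarrow> (\<And>i. i \<in> I \<Longrightarrow> f i \<in> K) \<Longrightarrow> e (sum f I) = (\<Sum>i\<in>I. e (f i))"
  by (induction I rule: infinite_finite_induct) (auto simp: aut_0 aut_add sum_mem)

lemma aut_prod: "e \<in> E \<Longrightarrow> (\<And>i. i \<in> I \<Longrightarrow> f i \<in> K) \<Longrightarrow> e (prod f I) = (\<Prod>i\<in>I. e (f i))"
  by (induction I rule: infinite_finite_induct) (auto simp: aut_1 aut_mult prod_mem)

text \<open>Composing on the left with \<open>e'\<close> permutes \<open>E\<close>, so it only
  reorders the summands; \<open>e''\<close> provides the inverse permutation.\<close>

lemma trace_fixed: assumes "y \<in> K" shows "(\<Sum>e\<in>E. e y) \<in> fixed_field"
proof -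
  have "e' (\<Sum>e\<in>E. e y) = (\<Sum>e\<in>E. e y)" if e': "e' \<in> E" for e'
  proof -
    obtain e'' where e'': "e'' \<in> E" "e'' \<circ> e' = id" "e' \<circ> e'' = id" using inv_E[OF e'] by blast
    have "e' (\<Sum>e\<in>E. e y) = (\<Sum>e\<in>E. (e' \<circ> e) y)"
      using aut_sum[OF e', of E "\<lambda>e. e y"] aut_mem assms by simp
    also have "\<dots> = (\<Sum>e\<in>E. e y)"
      by (rule sum.reindex_bij_witness[of _ "\<lambda>e. e'' \<circ> e" "\<lambda>e. e' \<circ> e"])
         (use e' e'' comp_E in \<open>auto simp: fun_eq_iff\<close>)
    finally show ?thesis .
  qed
  then show ?thesis using assms by (auto simp: fixed_field_def intro: sum_mem aut_mem)
qed

text \<open>Each product has at most \<open>card E - 1\<close> factors, which gives the degree bound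
  later. The only divisors are the nonzero differences \<open>x h - h (x h)\<close>, never
  \<open>card E\<close>, so the characteristic is arbitrary.\<close>

theorem interpolation:
  assumes f: "f \<in> K" and x: "\<And>h. h \<in> E - {id} \<Longrightarrow> x h \<in> K" "\<And>h. h \<in> E - {id} \<Longrightarrow> h (x h) \<noteq> x h"
  obtains c where "\<And>S. c S \<in> fixed_field" "f = (\<Sum>S\<in>Pow (E - {id}). c S * prod x S)"
proof -
  define D where "D = E - {id}"
  have D: "finite D" "\<And>h. h \<in> D \<Longrightarrow> h \<in> E" "\<And>h. h \<in> D \<Longrightarrow> x h \<in> K"
    "\<And>h. h \<in> D \<Longrightarrow> h (x h) \<in> K"
    using finite_E x(1) aut_mem by (auto simp: D_def)
  have moved: "x h - h (x h) \<noteq> 0" if "h \<in> D" for h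
    using x(2) that by (metis D_def right_minus_eq)
  \<comment> \<open>\<open>N S\<close> is the cofactor of \<open>prod x S\<close> in the expanded
    numerator for \<open>e = id\<close>, and \<open>Q\<close> is the inverse of the common
    denominator. Applying \<open>e\<close> to both yields the data for general
    \<open>e\<close>.\<close>
  define N where "N S = (\<Prod>h\<in>D - S. - h (x h))" for S
  define Q where "Q = inverse (\<Prod>h\<in>D. x h - h (x h))"
  have N: "N S \<in> K" for S unfolding N_def by (intro prod_mem uminus_mem D(4)) auto
  have Q: "Q \<in> K" unfolding Q_def by (intro inverse_mem prod_mem diff_mem D(3,4))
  define c where "c S = (\<Sum>e\<in>E. e (f * Q * N S))" for S
  have vanish: "(\<Prod>h\<in>D. x h - e (h (x h))) = 0" if e: "e \<in> E" "e \<noteq> id" for e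
  proof -
    obtain h where "h \<in> E" "e \<circ> h = id" using inv_E[OF e(1)] by blast
    \<comment> \<open>The inverse \<open>h\<close> is not \<open>id\<close>, since \<open>e\<close>
      is not; its factor in the product is zero.\<close>
    then have "h \<in> D" "e (h (x h)) = x h" using e(2) by (auto simp: D_def pointfree_idE)
    then show ?thesis using D(1) by (intro prod_zero bexI[of _ h]) auto
  qed
  have "(\<Sum>S\<in>Pow D. c S * prod x S) = (\<Sum>e\<in>E. \<Sum>S\<in>Pow D. e (f * Q * N S) * prod x S)"
    unfolding c_def sum_distrib_right by (rule sum.swap)
  also have "\<dots> = (\<Sum>e\<in>E. e (f * Q) * (\<Prod>h\<in>D. x h - e (h (x h))))"
  proof (rule sum.cong[OF refl])
    fix e assume e: "e \<in> E"
    have eN: "e (N S) = (\<Prod>h\<in>D - S. - e (h (x h)))" for S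
      unfolding N_def using e D by (subst aut_prod) (auto simp: aut_uminus uminus_mem)
    have "(\<Sum>S\<in>Pow D. e (f * Q * N S) * prod x S) =
        e (f * Q) * (\<Sum>S\<in>Pow D. prod x S * (\<Prod>h\<in>D - S. - e (h (x h))))"
      using e f Q N by (simp add: aut_mult mult_mem sum_distrib_left eN mult_ac)
    \<comment> \<open>Expansion of a product of binomials over the subsets of \<open>D\<close>, read
      backwards.\<close>
    also have "\<dots> = e (f * Q) * (\<Prod>h\<in>D. x h + - e (h (x h)))"
      by (subst prod_add[OF D(1)]) simp
    finally show "(\<Sum>S\<in>Pow D. e (f * Q * N S) * prod x S) =
        e (f * Q) * (\<Prod>h\<in>D. x h - e (h (x h)))" by simp
  qed
  also have "\<dots> = (\<Sum>e\<in>{id}. e (f * Q) * (\<Prod>h\<in>D. x h - e (h (x h))))"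
    by (rule sum.mono_neutral_right) (use finite_E id_E vanish in auto)
  also have "\<dots> = f"
    using D(1) moved by (simp add: Q_def)
  finally have "f = (\<Sum>S\<in>Pow (E - {id}). c S * prod x S)" by (simp add: D_def)
  moreover have "c S \<in> fixed_field" for S
    unfolding c_def by (intro trace_fixed mult_mem f Q N)
  ultimately show thesis using that by blast
qed

end


subsection \<open>The coordinate ring\<close>

text \<open>Lets the degrees of several monomials be summed over one index set.\<close>

lemma mon_degree_superset:
  "finite A \<Longrightarrow> Poly_Mapping.keys m \<subseteq> A \<Longrightarrow> mon_degree m = (\<Sum>i\<in>A. Poly_Mapping.lookup m i)"
  unfolding mon_degree_def by (rule sum.mono_neutral_left) (auto simp: in_keys_iff)

lemma mon_degree_add: "mon_degree (m + m') = mon_degree m + mon_degree m'"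
proof -
  let ?A = "Poly_Mapping.keys m \<union> Poly_Mapping.keys m'"
  have "Poly_Mapping.keys (m + m') \<subseteq> ?A" by (rule Poly_Mapping.keys_add)
  then show ?thesis
    by (subst (1 2 3) mon_degree_superset[of ?A]) (auto simp: lookup_add sum.distrib)
qed

lemma coord_ring_const: "const c \<in> coord_ring bs"
  by (auto simp: coord_ring_def const_def)

lemma coord_ring_0: "0 \<in> coord_ring bs"
  by (auto simp: coord_ring_def)

lemma coord_ring_le_1: "(1 :: 'k::field mpoly) \<in> coord_ring_le bs 0"
  by (auto simp: coord_ring_def coord_ring_le_def mon_degree_def simp flip: single_one)

lemma coord_ring_1: "(1 :: 'k::field mpoly) \<in> coord_ring bs"
  using coord_ring_le_1 by (auto simp: coord_ring_le_def)

lemma coord_ring_le_var: "i < length bs \<Longrightarrow> (var i :: 'k::field mpoly) \<in> coord_ring_le bs 1"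
  by (auto simp: coord_ring_def coord_ring_le_def var_def mon_degree_def)

lemma coord_ring_var: "i < length bs \<Longrightarrow> (var i :: 'k::field mpoly) \<in> coord_ring bs"
  using coord_ring_le_var by (auto simp: coord_ring_le_def)

lemma coord_ring_add: "p \<in> coord_ring bs \<Longrightarrow> q \<in> coord_ring bs \<Longrightarrow> p + q \<in> coord_ring bs"
  using Poly_Mapping.keys_add[of p q] by (auto simp: coord_ring_def)

lemma coord_ring_mult:
  assumes "p \<in> coord_ring bs" "q \<in> coord_ring bs"
  shows "p * q \<in> (coord_ring bs :: 'k::field mpoly set)"
  unfolding coord_ring_def
proof (intro CollectI ballI)
  fix m assume "m \<in> Poly_Mapping.keys (p * q)"
  then obtain a b where "m = a + b" "a \<in> Poly_Mapping.keys p" "b \<in> Poly_Mapping.keys q"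
    using keys_mult[of p q] by blast
  then show "Poly_Mapping.keys m \<subseteq> {..<length bs}"
    using assms Poly_Mapping.keys_add[of a b] by (fastforce simp: coord_ring_def)
qed

lemma coord_ring_le_mult:
  assumes "p \<in> coord_ring_le bs d" "q \<in> coord_ring_le bs d'"
  shows "p * q \<in> (coord_ring_le bs (d + d') :: 'k::field mpoly set)"
proof -
  have "mon_degree m \<le> d + d'" if "m \<in> Poly_Mapping.keys (p * q)" for m
  proof -
    obtain a b where "m = a + b" "a \<in> Poly_Mapping.keys p" "b \<in> Poly_Mapping.keys q"
      using keys_mult[of p q] \<open>m \<in> _\<close> by blast
    then show ?thesis using assms by (auto simp: coord_ring_le_def mon_degree_add intro!: add_mono)
  qed
  then show ?thesis using assms coord_ring_mult[of p bs q] by (auto simp: coord_ring_le_def)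
qed

lemma coord_ring_le_mono: "d \<le> d' \<Longrightarrow> coord_ring_le bs d \<subseteq> coord_ring_le bs d'"
  by (auto simp: coord_ring_le_def)

lemma coord_ring_le_prod:
  assumes "finite A" "\<And>a. a \<in> A \<Longrightarrow> p a \<in> coord_ring_le bs 1"
  shows "prod p A \<in> (coord_ring_le bs (card A) :: 'k::field mpoly set)"
  using assms
proof (induction A rule: finite_induct)
  case (insert a A)
  then show ?case using coord_ring_le_mult[of "p a" bs 1 "prod p A" "card A"] by simp
qed (simp add: coord_ring_le_1)

lemma coord_ring_sum: "(\<And>a. a \<in> A \<Longrightarrow> p a \<in> coord_ring bs) \<Longrightarrow> sum p A \<in> coord_ring bs"
  by (induction A rule: infinite_finite_induct) (auto intro: coord_ring_0 coord_ring_add)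

lemma coord_ring_prod:
  "(\<And>a. a \<in> A \<Longrightarrow> p a \<in> coord_ring bs) \<Longrightarrow> prod p A \<in> (coord_ring bs :: 'k::field mpoly set)"
  by (induction A rule: infinite_finite_induct) (auto intro: coord_ring_1 coord_ring_mult)

lemma coord_ring_power:
  "p \<in> coord_ring bs \<Longrightarrow> p ^ n \<in> (coord_ring bs :: 'k::field mpoly set)"
  by (induction n) (auto intro: coord_ring_1 coord_ring_mult)

lemma coord_ring_linear_form: "linear_form bs l \<in> coord_ring bs"
  unfolding linear_form_def
  by (auto intro!: coord_ring_sum coord_ring_mult coord_ring_const coord_ring_var)

text \<open>Every variable, whatever its index, is replaced by a linear form in the coordinates of
  \<open>bs\<close>.\<close>

lemma coord_ring_poly_act: "poly_act G scale bs \<rho> g p \<in> coord_ring bs"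
  unfolding poly_act_def mpoly_eval_def
  by (intro coord_ring_sum coord_ring_mult coord_ring_const coord_ring_prod coord_ring_power
      coord_ring_linear_form)

section \<open>Closure of \<open>k(V)\<close> under the field operations\<close>

lemma rat_fun_fieldE:
  assumes "f \<in> rat_fun_field bs"
  obtains p q where "p \<in> coord_ring bs" "q \<in> coord_ring bs" "q \<noteq> 0" "f = Fract p q"
  using assms by (auto simp: rat_fun_field_def)

lemma Fract_in_rat_fun_field:
  "p \<in> coord_ring bs \<Longrightarrow> q \<in> coord_ring bs \<Longrightarrow> q \<noteq> 0 \<Longrightarrow> Fract p q \<in> rat_fun_field bs"
  by (auto simp: rat_fun_field_def)

lemma to_fract_in_rat_fun_field: "p \<in> coord_ring bs \<Longrightarrow> to_fract p \<in> rat_fun_field bs"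
  unfolding to_fract_def by (rule Fract_in_rat_fun_field) (auto intro: coord_ring_1)

lemma to_fract_prod: "to_fract (prod f A) = (\<Prod>a\<in>A. to_fract (f a))"
  by (induction A rule: infinite_finite_induct) auto

lemma rat_fun_field_add:
  assumes "f \<in> rat_fun_field bs" "f' \<in> rat_fun_field bs"
  shows "f + f' \<in> rat_fun_field bs"
  using assms
  by (elim rat_fun_fieldE) (auto intro!: Fract_in_rat_fun_field coord_ring_add coord_ring_mult)

lemma rat_fun_field_mult:
  assumes "f \<in> rat_fun_field bs" "f' \<in> rat_fun_field bs"
  shows "f * f' \<in> rat_fun_field bs"
  using assms
  by (elim rat_fun_fieldE) (auto intro!: Fract_in_rat_fun_field coord_ring_mult)

lemma rat_fun_field_inverse:
  assumes "f \<in> rat_fun_field bs"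
  shows "inverse f \<in> rat_fun_field bs"
proof -
  obtain p q where *: "p \<in> coord_ring bs" "q \<in> coord_ring bs" "q \<noteq> 0" "f = Fract p q"
    using assms by (rule rat_fun_fieldE)
  \<comment> \<open>A nonzero fraction is inverted by swapping numerator and denominator; for zero,
    \<open>inverse 0 = 0\<close>.\<close>
  show ?thesis
  proof (cases "p = 0")
    case True
    with * have "f = 0" by (simp add: fract_collapse)
    then show ?thesis using assms by simp
  next
    case False
    then show ?thesis using * by (simp add: Fract_in_rat_fun_field)
  qed
qed


subsection \<open>Spanning in degree at most \<open>|G| - 1\<close>\<close>

context fin_dim_rep
begin

section \<open>The image of \<open>G\<close> among the automorphisms of \<open>k(V)\<close>\<close>

abbreviation "KV \<equiv> rat_fun_field bs :: 'k mpoly fract set"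

text \<open>Outside \<open>k(V)\<close> the value of \<^term>\<open>ract g\<close> is junk; replacing it by the identity there makes
  equality and composition of these maps agree with those of automorphisms of \<open>k(V)\<close>.\<close>

definition field_aut :: "'g \<Rightarrow> 'k mpoly fract \<Rightarrow> 'k mpoly fract"
  where "field_aut g f = (if f \<in> KV then ract g f else f)"

lemma field_aut_Fract:
  assumes "p \<in> coord_ring bs" "q \<in> coord_ring bs" "q \<noteq> 0" "g \<in> carrier G"
  shows "field_aut g (Fract p q) = Fract (act g p) (act g q)"
  using assms by (simp add: field_aut_def rat_act_Fract Fract_in_rat_fun_field)

lemma field_aut_mem: "f \<in> KV \<Longrightarrow> g \<in> carrier G \<Longrightarrow> field_aut g f \<in> KV"
  by (elim rat_fun_fieldE)
     (simp add: field_aut_Fract Fract_in_rat_fun_field coord_ring_poly_act poly_act_eq_0_iff)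

lemma field_aut_mult:
  assumes "g \<in> carrier G" "h \<in> carrier G"
  shows "field_aut g \<circ> field_aut h = field_aut (g \<otimes> h)"
proof
  fix f
  show "(field_aut g \<circ> field_aut h) f = field_aut (g \<otimes> h) f"
  proof (cases "f \<in> KV")
    case True
    then show ?thesis using assms
      by (elim rat_fun_fieldE)
         (simp add: field_aut_Fract coord_ring_poly_act poly_act_eq_0_iff poly_act_mult)
  qed (simp add: field_aut_def)
qed

text \<open>The action is by substitution, hence determined by the images of the variables. Read
  contrapositively, it gives every nonidentity automorphism a coordinate function that it
  moves.\<close>

lemma field_aut_eq_id:
  assumes "g \<in> carrier G" "\<And>i. i < length bs \<Longrightarrow> act g (var i) = var i"
  shows "field_aut g = id"
proof
  fix f
  have act: "act g p = p" if "p \<in> coord_ring bs" for p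
  proof -
    have "act g p = mpoly_eval const (\<lambda>i. act g (var i)) p"
      by (simp add: poly_act_def const.eval_var)
    also have "\<dots> = mpoly_eval const var p" by (rule mpoly_eval_cong[OF that assms(2)])
    finally show ?thesis by (simp add: eval_vars)
  qed
  show "field_aut g f = id f"
  proof (cases "f \<in> KV")
    case True
    then show ?thesis using assms(1) by (elim rat_fun_fieldE) (simp add: field_aut_Fract act)
  qed (simp add: field_aut_def)
qed

lemma field_aut_one: "field_aut \<one> = id"
  by (rule field_aut_eq_id) (auto simp: poly_act_one coord_ring_var)

lemma field_aut_hom:
  assumes "f \<in> KV" "f' \<in> KV" "g \<in> carrier G"
  shows "field_aut g (f + f') = field_aut g f + field_aut g f'"
    and "field_aut g (f * f') = field_aut g f * field_aut g f'"
proof -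
  obtain p q p' q' where *: "p \<in> coord_ring bs" "q \<in> coord_ring bs" "q \<noteq> 0" "f = Fract p q"
     "p' \<in> coord_ring bs" "q' \<in> coord_ring bs" "q' \<noteq> 0" "f' = Fract p' q'"
    using assms(1,2) by (elim rat_fun_fieldE)
  have act: "act g (a + b) = act g a + act g b" "act g (a * b) = act g a * act g b" for a b
    by (simp_all add: poly_act_def const.eval_add const.eval_mult)
  show "field_aut g (f + f') = field_aut g f + field_aut g f'"
    and "field_aut g (f * f') = field_aut g f * field_aut g f'"
    using * assms(3)
    by (simp_all add: field_aut_Fract coord_ring_add coord_ring_mult act poly_act_eq_0_iff)
qed

text \<open>\<open>field_aut\<close> turns products in \<open>G\<close> into compositions, so its
  image inherits identity and inverses. Passing to the image identifies group elements that act
  alike, as happens for an unfaithful representation.\<close>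

lemma finite_automorphism_group_field_aut:
  assumes "finite (carrier G)"
  shows "finite_automorphism_group KV (field_aut ` carrier G)"
proof
  show "1 \<in> KV"
    using to_fract_in_rat_fun_field[OF coord_ring_1] by simp
  show "- f \<in> KV" if "f \<in> KV" for f
  proof -
    \<comment> \<open>Negation is multiplication by the constant -1.\<close>
    have "to_fract (const (- 1)) * f \<in> KV"
      by (intro rat_fun_field_mult to_fract_in_rat_fun_field coord_ring_const that)
    moreover have "const (- 1 :: 'k) = - 1"
      by (simp add: const_def single_uminus)
    ultimately show ?thesis by simp
  qed
  show "id \<in> field_aut ` carrier G"
    using field_aut_one G.one_closed by (metis imageI)
  show "e \<circ> e' \<in> field_aut ` carrier G" if "e \<in> field_aut ` carrier G" "e' \<in> field_aut ` carrier G" for e e'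
    using that by (auto simp: field_aut_mult)
  show "\<exists>e'\<in>field_aut ` carrier G. e' \<circ> e = id \<and> e \<circ> e' = id" if e: "e \<in> field_aut ` carrier G" for e
  proof -
    obtain g where g: "g \<in> carrier G" "e = field_aut g" using e by blast
    then show ?thesis
      by (intro bexI[of _ "field_aut (inv g)"]) (auto simp: field_aut_mult field_aut_one)
  qed
qed (use assms in \<open>auto simp: field_aut_mem field_aut_hom rat_fun_field_add rat_fun_field_mult
      rat_fun_field_inverse\<close>)

theorem span_coord_ring_le:
  assumes "finite (carrier G)"
  shows "span_over (inv_field G scale bs \<rho>) (to_fract ` coord_ring_le bs (order G - 1)) = KV"
proof (intro equalityI subsetI)
  define E where "E = field_aut ` carrier G"
  interpret aut: finite_automorphism_group KV E
    unfolding E_def by (rule finite_automorphism_group_field_aut[OF assms])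
  \<comment> \<open>On \<open>KV\<close> the maps \<open>field_aut g\<close> and
    \<open>ract g\<close> agree.\<close>
  have inv_field: "aut.fixed_field = inv_field G scale bs \<rho>"
    unfolding aut.fixed_field_def inv_field_def by (auto simp: E_def field_aut_def)
  {
    fix f assume "f \<in> span_over (inv_field G scale bs \<rho>) (to_fract ` coord_ring_le bs (order G - 1))"
    then obtain T c where "f = (\<Sum>s\<in>T. c s * s)" "T \<subseteq> to_fract ` coord_ring_le bs (order G - 1)"
        "c ` T \<subseteq> inv_field G scale bs \<rho>"
      by (auto simp: span_over_def)
    then show "f \<in> KV"
      by (auto simp: inv_field_def coord_ring_le_def
        intro!: aut.sum_mem aut.mult_mem to_fract_in_rat_fun_field)
  }
  fix f assume f: "f \<in> KV"
  have "\<exists>i<length bs. h (to_fract (var i)) \<noteq> to_fract (var i)" if h: "h \<in> E - {id}" for h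
  proof -
    obtain g where g: "g \<in> carrier G" "h = field_aut g" "field_aut g \<noteq> id"
      using h by (auto simp: E_def)
    then obtain i where i: "i < length bs" "act g (var i) \<noteq> var i"
      using field_aut_eq_id by blast
    \<comment> \<open>\<open>to_fract p\<close> is \<open>Fract p 1\<close>, so the denominator must
      be preserved.\<close>
    have "act g 1 = 1" by (simp add: poly_act_def const.eval_1)
    then have "h (to_fract (var i)) = to_fract (act g (var i))"
      using g i by (simp add: to_fract_def field_aut_Fract coord_ring_var coord_ring_1)
    then show ?thesis using i by auto
  qed
  then obtain i where i: "\<And>h. h \<in> E - {id} \<Longrightarrow> i h < length bs"
      "\<And>h. h \<in> E - {id} \<Longrightarrow> h (to_fract (var (i h))) \<noteq> to_fract (var (i h))"
    by metis
  obtain c where c: "\<And>S. c S \<in> aut.fixed_field"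
      "f = (\<Sum>S\<in>Pow (E - {id}). c S * (\<Prod>h\<in>S. to_fract (var (i h))))"
    by (rule aut.interpolation[OF f, of "\<lambda>h. to_fract (var (i h))"])
       (use i in \<open>auto intro: to_fract_in_rat_fun_field coord_ring_var\<close>)
  \<comment> \<open>One variable per element of \<open>S\<close>; leaving out \<open>id\<close>
    accounts for the -1. The final bound by \<open>order G\<close> may be strict, since
    \<open>E\<close> is only an image of \<open>G\<close>.\<close>
  have "(\<Prod>h\<in>S. var (i h) :: 'k mpoly) \<in> coord_ring_le bs (order G - 1)" if "S \<subseteq> E - {id}" for S
  proof -
    have "card S \<le> card (E - {id})" using that aut.finite_E by (intro card_mono) auto
    also have "\<dots> = card E - 1" using aut.id_E by simp
    also have "\<dots> \<le> order G - 1"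
      unfolding order_def E_def by (intro diff_le_mono card_image_le assms)
    finally have "card S \<le> order G - 1" .
    moreover have "(\<Prod>h\<in>S. var (i h) :: 'k mpoly) \<in> coord_ring_le bs (card S)"
      by (rule coord_ring_le_prod[OF finite_subset[OF that]])
         (use aut.finite_E i(1) that in \<open>auto intro!: coord_ring_le_var[unfolded One_nat_def]\<close>)
    ultimately show ?thesis using coord_ring_le_mono by blast
  qed
  \<comment> \<open>Different subsets can give the same monomial, as \<open>i\<close> may repeat;
    \<open>span_overI\<close> merges their coefficients.\<close>
  then show "f \<in> span_over (inv_field G scale bs \<rho>) (to_fract ` coord_ring_le bs (order G - 1))"
    unfolding c(2) inv_field[symmetric] using aut.finite_E c(1)
    by (intro span_overI)
       (auto simp: aut.fixed_field_def aut.zero_mem aut.aut_0 aut.add_mem aut.aut_add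
         simp flip: to_fract_prod)
qed

end

theorem theorem4p7:
  fixes G :: "('g, 'm) monoid_scheme"
    and scale :: "'k::field \<Rightarrow> 'v::ab_group_add \<Rightarrow> 'v"
    and bs :: "'v list"
    and \<rho> :: "'g \<Rightarrow> 'v \<Rightarrow> 'v"
  assumes "finite (carrier G)"
    and "fin_dim_rep G scale bs \<rho>"
  shows "spanning_degree G scale bs \<rho> \<le> enat (order G - 1)"
  \<comment> \<open>The spanning degree is an infimum, so one degree that spans bounds it.\<close>
  unfolding spanning_degree_def
  by (intro INF_lower CollectI fin_dim_rep.span_coord_ring_le assms)

end
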